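(* A poset $P$ is a chainmail if and only if for every element $x\in P$, the set $x^\uparrow=\{y\in P\mid x\leqslant y\}$, with the induced partial order, is a complete lattice.
   Context: In a poset $P$, a mail is a non-empty subset of $P$ having a common lower bound in $P$. A subset $M$ of $P$ is mail-connected if $M\neq\varnothing$ and for any $x,y\in M$ there is a sequence $s_1,\dots,s_n\in M$ with $s_1=x$, $s_n=y$ and each $\{s_i,s_{i+1}\}$ ($1\le i\le n-1$) a mail in $P$. A chainmail is a poset in which every mail-connected subset has a join. *)

theory Defs
  imports "HOL-Algebra.Complete_Lattice"
begin

definition mail :: "('a, 'b) gorder_scheme \<Rightarrow> 'a set \<Rightarrow> bool" where
  "mail P M \<longleftrightarrow> M \<subseteq> carrier P \<and> M \<noteq> {} \<and> Lower P M \<noteq> {}"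

definition mail_connected :: "('a, 'b) gorder_scheme \<Rightarrow> 'a set \<Rightarrow> bool" where
  "mail_connected P M \<longleftrightarrow>
     M \<subseteq> carrier P \<and> M \<noteq> {} \<and>
     (\<forall>x\<in>M. \<forall>y\<in>M. \<exists>(n::nat) s. 1 \<le> n \<and> (\<forall>i\<in>{1..n}. s i \<in> M) \<and> s 1 = x \<and> s n = y \<and>
        (\<forall>i\<in>{1..<n}. mail P {s i, s (i + 1)}))"

locale chainmail = partial_order P for P (structure) +
  assumes join_exists: "mail_connected P M \<Longrightarrow> \<exists>j. is_lub P j M"

definition principal_upset :: "('a, 'b) gorder_scheme \<Rightarrow> 'a \<Rightarrow> 'a set" where
  "principal_upset P x = {y \<in> carrier P. x \<sqsubseteq>\<^bsub>P\<^esub> y}"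

end

(* The forward direction rests on every non-empty subset of a principal upset being mail-connected.
   Conversely, let U be the set of upper bounds of a mail-connected set M, and for m in M let i(m)
   be the meet of U inside the upset of m. If m and m' share a lower bound z, then i(m) and i(m')
   both coincide with the meet of U inside the upset of z. Along chains of mails, i is therefore
   constant on M; its value is above every m in M and below U, so it is the join of M. If U is
   empty, i(m) is the top of the upset of m, and the same argument applies. *)
theory Submission
  imports Defs
begin

text \<open>With bounds spelled out elementwise, joins in \<open>L\<close> and in the induced order
  on a subset differ only in the carrier, so one can be turned into the other.\<close>

lemma least_Upper_iff:
  assumes "A \<subseteq> carrier L"
  shows "least L s (Upper L A) \<longleftrightarrow> s \<in> carrier L \<and> (\<forall>a\<in>A. a \<sqsubseteq>\<^bsub>L\<^esub> s) \<and>
    (\<forall>u\<in>carrier L. (\<forall>a\<in>A. a \<sqsubseteq>\<^bsub>L\<^esub> u) \<longrightarrow> s \<sqsubseteq>\<^bsub>L\<^esub> u)"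
  using assms unfolding least_def Upper_def by blast

lemma greatest_Lower_iff:
  assumes "A \<subseteq> carrier L"
  shows "greatest L i (Lower L A) \<longleftrightarrow> i \<in> carrier L \<and> (\<forall>a\<in>A. i \<sqsubseteq>\<^bsub>L\<^esub> a) \<and>
    (\<forall>l\<in>carrier L. (\<forall>a\<in>A. l \<sqsubseteq>\<^bsub>L\<^esub> a) \<longrightarrow> l \<sqsubseteq>\<^bsub>L\<^esub> i)"
  using assms unfolding greatest_def Lower_def by blast

lemma (in partial_order) partial_order_subset:
  assumes "A \<subseteq> carrier L"
  shows "partial_order (L\<lparr>carrier := A\<rparr>)"
proof -
  interpret sub: weak_partial_order "L\<lparr>carrier := A\<rparr>"
    by (rule weak_partial_order_subset[OF weak_partial_order_axioms assms])
  show ?thesis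
    by unfold_locales (simp add: eq_is_equal)
qed

text \<open>The meet of \<open>A\<close> is the join of \<open>Lower L A\<close>: every element of
  \<open>A\<close> is an upper bound of that set, hence lies above its join.\<close>

lemma (in partial_order) complete_lattice_if_sups:
  assumes sups: "\<And>A. A \<subseteq> carrier L \<Longrightarrow> \<exists>s. least L s (Upper L A)"
  shows "complete_lattice L"
proof
  fix A assume A: "A \<subseteq> carrier L"
  obtain i where "least L i (Upper L (Lower L A))"
    using sups[of "Lower L A"] by auto
  then have i: "i \<in> carrier L" "\<And>l. l \<in> Lower L A \<Longrightarrow> l \<sqsubseteq> i"
      "\<And>u. u \<in> carrier L \<Longrightarrow> (\<forall>l\<in>Lower L A. l \<sqsubseteq> u) \<Longrightarrow> i \<sqsubseteq> u"
    by (auto simp: least_Upper_iff)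
  have "i \<sqsubseteq> a" if "a \<in> A" for a
    using i(3)[of a] that A by blast
  then have "greatest L i (Lower L A)"
    using i A by (intro greatest_LowerI) auto
  then show "\<exists>i. greatest L i (Lower L A)" ..
qed (rule sups)

lemma (in partial_order) principal_upset_subset_carrier: "principal_upset L x \<subseteq> carrier L"
  by (auto simp: principal_upset_def)

text \<open>Any two elements of \<open>M\<close> form a mail, with \<open>x\<close> as common lower
  bound, so a sequence of two terms connects them.\<close>

lemma mail_connected_if_bounded_below:
  fixes L (structure)
  assumes "M \<subseteq> carrier L" "M \<noteq> {}" "x \<in> carrier L" "\<And>m. m \<in> M \<Longrightarrow> x \<sqsubseteq> m"
  shows "mail_connected L M"
  unfolding mail_connected_def
proof (intro conjI ballI)
  fix a b assume ab: "a \<in> M" "b \<in> M"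
  define s where "s i = (if i = Suc 0 then a else b)" for i
  have "x \<in> Lower L {a, b}"
    using assms ab by (auto simp: Lower_def)
  then have "mail L {a, b}"
    using assms ab by (auto simp: mail_def)
  then have "1 \<le> (2::nat) \<and> (\<forall>i\<in>{1..2}. s i \<in> M) \<and> s 1 = a \<and> s 2 = b \<and>
      (\<forall>i\<in>{1..<2}. mail L {s i, s (i + 1)})"
    using ab by (auto simp: s_def)
  then show "\<exists>(n::nat) s. 1 \<le> n \<and> (\<forall>i\<in>{1..n}. s i \<in> M) \<and> s 1 = a \<and> s n = b \<and>
      (\<forall>i\<in>{1..<n}. mail L {s i, s (i + 1)})"
    by blast
qed (use assms in auto)

text \<open>Induction along a sequence of mails from \<open>a\<close> to \<open>b\<close>: a
  property that passes across every mail inside \<open>M\<close> reaches all of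
  \<open>M\<close>.\<close>

lemma mail_connected_propagate:
  assumes "mail_connected L M" "a \<in> M" "b \<in> M" "Q a"
    and step: "\<And>c d. c \<in> M \<Longrightarrow> d \<in> M \<Longrightarrow> mail L {c, d} \<Longrightarrow> Q c \<Longrightarrow> Q d"
  shows "Q b"
proof -
  obtain n :: nat and s where s: "1 \<le> n" "\<forall>i\<in>{1..n}. s i \<in> M" "s 1 = a" "s n = b"
      "\<forall>i\<in>{1..<n}. mail L {s i, s (i + 1)}"
    using assms(1-3) unfolding mail_connected_def by blast
  have "Q (s k)" if "1 \<le> k" "k \<le> n" for k
    using that
  proof (induction k rule: dec_induct)
    case base
    show ?case using s(3) \<open>Q a\<close> by simp
  next
    case (step k)
    then show ?case
      using s(2,5) assms(5)[of "s k" "s (Suc k)"] by auto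
  qed
  then show ?thesis using s(1,4) by auto
qed

lemma (in chainmail) complete_lattice_principal_upset:
  assumes x: "x \<in> carrier P"
  shows "complete_lattice (P\<lparr>carrier := principal_upset P x\<rparr>)" (is "complete_lattice ?Q")
proof -
  interpret Q: partial_order ?Q
    using principal_upset_subset_carrier by (rule partial_order_subset)
  show ?thesis
  proof (rule Q.complete_lattice_if_sups)
    fix A assume A: "A \<subseteq> carrier ?Q"
    show "\<exists>s. least ?Q s (Upper ?Q A)"
    \<comment> \<open>The empty set is not mail-connected, so \<open>join_exists\<close> does not
      cover it; its join in the upset is the bottom element \<open>x\<close>.\<close>
    proof (cases "A = {}")
      case True
      then have "least ?Q x (Upper ?Q A)"
        using x by (auto simp: least_def principal_upset_def)
      then show ?thesis ..
    next
      case False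
      then have A': "A \<subseteq> carrier P" "\<And>a. a \<in> A \<Longrightarrow> x \<sqsubseteq> a"
        using A by (auto simp: principal_upset_def)
      then obtain j where "least P j (Upper P A)"
        using join_exists mail_connected_if_bounded_below[OF A'(1) False x] by blast
      moreover obtain a where "a \<in> A" using False by blast
      \<comment> \<open>An element \<open>a\<close> of \<open>A\<close> lies between
        \<open>x\<close> and \<open>j\<close>, which puts the join taken in \<open>P\<close> inside
        the upset.\<close>
      ultimately have j: "least P j (Upper P A)" "x \<sqsubseteq> j"
        using le_trans[OF A'(2), of a j] A'(1) x unfolding least_Upper_iff[OF A'(1)] by auto
      then have "least ?Q j (Upper ?Q A)"
        using A unfolding least_Upper_iff[OF A'(1)] least_Upper_iff[OF A]
        by (auto simp: principal_upset_def)
      then show ?thesis ..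
    qed
  qed
qed

lemma (in partial_order) chainmail_if_complete_upsets:
  assumes complete: "\<And>x. x \<in> carrier L \<Longrightarrow> complete_lattice (L\<lparr>carrier := principal_upset L x\<rparr>)"
  shows "chainmail L"
proof
  fix M assume conn: "mail_connected L M"
  then have M: "M \<subseteq> carrier L" "M \<noteq> {}"
    by (auto simp: mail_connected_def)
  define U where "U = Upper L M"
  have U: "U \<subseteq> carrier L" by (simp add: U_def)
  \<comment> \<open>For \<open>x\<close> below all of \<open>U\<close>, this is the meet of
    \<open>U\<close> in the upset of \<open>x\<close>, expressed in \<open>L\<close> itself so that
    meets in different upsets can be compared.\<close>
  define is_meet where "is_meet x i \<longleftrightarrow> i \<in> carrier L \<and> x \<sqsubseteq> i \<and> (\<forall>u\<in>U. i \<sqsubseteq> u) \<and>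
      (\<forall>l\<in>carrier L. x \<sqsubseteq> l \<longrightarrow> (\<forall>u\<in>U. l \<sqsubseteq> u) \<longrightarrow> l \<sqsubseteq> i)" for x i
  have meet: "\<exists>i. is_meet x i" if x: "x \<in> carrier L" "\<And>u. u \<in> U \<Longrightarrow> x \<sqsubseteq> u" for x
  proof -
    interpret Q: complete_lattice "L\<lparr>carrier := principal_upset L x\<rparr>"
      by (rule complete[OF x(1)])
    have *: "U \<subseteq> carrier (L\<lparr>carrier := principal_upset L x\<rparr>)"
      using x U by (auto simp: principal_upset_def)
    show ?thesis
      using Q.inf_exists[OF *] unfolding greatest_Lower_iff[OF *]
      by (auto simp: principal_upset_def is_meet_def)
  qed
  have below: "m \<sqsubseteq> u" if "m \<in> M" "u \<in> U" for m u
    using that M(1) by (auto simp: U_def)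
  have step: "is_meet d i"
    if cd: "c \<in> M" "d \<in> M" and "mail L {c, d}" and c: "is_meet c i" for c d i
  proof -
    have cdL: "c \<in> carrier L" "d \<in> carrier L"
      using cd M by auto
    from \<open>mail L {c, d}\<close> obtain z where z: "z \<in> carrier L" "z \<sqsubseteq> c" "z \<sqsubseteq> d"
      by (auto simp: mail_def Lower_def)
    have zU: "z \<sqsubseteq> u" if "u \<in> U" for u
      using le_trans[OF z(2) below[OF cd(1) that]] that z cdL U by auto
    obtain k where k: "is_meet z k"
      using meet[OF z(1) zU] by blast
    \<comment> \<open>Both \<open>c\<close> and \<open>d\<close> are lower bounds of
      \<open>U\<close> in the upset of \<open>z\<close>, so the greatest such bound \<open>k\<close>
      is above them.\<close>
    have "d \<sqsubseteq> k" "c \<sqsubseteq> k"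
      using k cd cdL z below by (auto simp: is_meet_def)
    have "k \<sqsubseteq> i"
      using c k \<open>c \<sqsubseteq> k\<close> by (simp add: is_meet_def)
    moreover have "i \<sqsubseteq> k"
    proof -
      have "z \<sqsubseteq> i" using le_trans[OF z(2), of i] c z cdL by (simp add: is_meet_def)
      then show ?thesis using c k by (simp add: is_meet_def)
    qed
    ultimately have "i = k"
      using c k by (intro le_antisym) (simp_all add: is_meet_def)
    \<comment> \<open>The upset of \<open>d\<close> is contained in that of \<open>z\<close>, so
      \<open>k\<close> remains greatest there.\<close>
    have "l \<sqsubseteq> k" if l: "l \<in> carrier L" "d \<sqsubseteq> l" "\<forall>u\<in>U. l \<sqsubseteq> u" for l
    proof -
      have "z \<sqsubseteq> l" using le_trans[OF z(3) l(2)] z l cdL by simp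
      then show ?thesis using k l by (simp add: is_meet_def)
    qed
    then show ?thesis
      using k \<open>d \<sqsubseteq> k\<close> by (simp add: \<open>i = k\<close> is_meet_def)
  qed
  obtain m where m: "m \<in> M" using M by blast
  then obtain i where i: "is_meet m i"
    using meet[of m] below M by blast
  have "is_meet m' i" if "m' \<in> M" for m'
    by (rule mail_connected_propagate[OF conn m that, of "\<lambda>x. is_meet x i"]) (fact i, rule step)
  \<comment> \<open>Each \<open>is_meet m' i\<close> contains \<open>m'\<close> \<sqsubseteq>
    \<open>i\<close>, so \<open>i\<close> is an upper bound of \<open>M\<close>, and it lies below
    all of \<open>U\<close>.\<close>
  then have "least L i (Upper L M)"
    using i M(1) by (intro least_UpperI) (auto simp: is_meet_def U_def)
  then show "\<exists>j. is_lub L j M" ..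
qed

theorem mainTheorem6:
  fixes P :: "('a, 'b) gorder_scheme"
  assumes "partial_order P"
  shows "chainmail P \<longleftrightarrow>
    (\<forall>x\<in>carrier P. complete_lattice (P\<lparr>carrier := principal_upset P x\<rparr>))"
proof
  assume "chainmail P"
  then show "\<forall>x\<in>carrier P. complete_lattice (P\<lparr>carrier := principal_upset P x\<rparr>)"
    by (simp add: chainmail.complete_lattice_principal_upset)
next
  assume "\<forall>x\<in>carrier P. complete_lattice (P\<lparr>carrier := principal_upset P x\<rparr>)"
  then show "chainmail P"
    by (intro partial_order.chainmail_if_complete_upsets[OF assms]) simp
qed

end
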